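(* Let $\mathcal{Q}=\{(x,y): x>0,\ y>0,\ x^2+y^2=1\}$, let $T:\mathcal{Q}\to\overline{\mathcal{Q}}$ be the transformation $T(x,y)=\left(\frac{|2-x-2y|}{3-2x-2y},\frac{|2-2x-y|}{3-2x-2y}\right)$, and let $\mu$ be the measure $d\mu(x,y)=\frac{ds}{\sqrt{(1-x)(1-y)}}$ on $\mathcal{Q}$, where $ds$ is arc length on the unit circle. Let $$D(t)=\left(\frac{1-t^2}{1+t^2},\ \frac{2t}{1+t^2}\right),$$ which maps the interval $(0,1)$ bijectively onto $\mathcal{Q}$. Then $(\mathcal{Q},T,\mu)$ is conjugate, by the mapping $D$, to the measure-preserving system $((0,1),\hat T,\nu)$, where $$\hat T(t)=(D^{-1}\circ T\circ D)(t)=\begin{cases}\dfrac{t}{1-2t}, & 0<t<\frac13,\\[2mm] \dfrac1t-2, & \frac13<t<\frac12,\\[2mm] 2-\dfrac1t, & \frac12<t<1,\end{cases}\qquad d\nu(t)=\frac{1}{\sqrt2}\cdot\frac{dt}{t(1-t)}.$$ The mapping $\hat T$ is the scaling of a modified slow (subtractive) Euclidean algorithm.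
   Context: The modified slow Euclidean algorithm in question is the mapping defined on pairs $(x,y)$ with $x>y$ by $$(x,y)\longrightarrow\begin{cases}(x-2y,\,y) & \text{if } x-2y>y,\\ (y,\,x-2y) & \text{if } y\ge x-2y>0,\\ (y,\,2y-x) & \text{if } x-2y\le 0.\end{cases}$$ "Scaling" means always replacing $x$ by $1$ and $y$ by the ratio $y/x$, so that the algorithm induces a map of the ratio $t=y/x\in(0,1)$. $\overline{\mathcal{Q}}$ denotes the closure of $\mathcal{Q}$.
   Formalization: With the printed constant 1/√2 in ν, the image of ν under D is μ/2, not μ (the pullback of μ is √2·dt/(t(1−t))); conjugacy is therefore stated with D carrying ν to (1/2)μ, both measures being kept as printed. *)

theory Defs
  imports "HOL-Analysis.Analysis"
begin

definition quarter_circle :: "(real \<times> real) set" where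
  "quarter_circle = {(x, y). x > 0 \<and> y > 0 \<and> x\<^sup>2 + y\<^sup>2 = 1}"

definition circle_map :: "real \<times> real \<Rightarrow> real \<times> real" where
  "circle_map = (\<lambda>(x, y).
     (\<bar>2 - x - 2 * y\<bar> / (3 - 2 * x - 2 * y), \<bar>2 - 2 * x - y\<bar> / (3 - 2 * x - 2 * y)))"

text \<open>Arc length on the unit circle is the image of Lebesgue measure under the unit-speed
  parametrization by the angle.\<close>

definition circle_arc_length :: "(real \<times> real) measure" where
  "circle_arc_length =
     distr (restrict_space lborel {0..<2 * pi}) borel (\<lambda>\<theta>. (cos \<theta>, sin \<theta>))"

definition circle_measure :: "(real \<times> real) measure" where
  "circle_measure =
     density (restrict_space circle_arc_length quarter_circle)
       (\<lambda>(x, y). ennreal (1 / sqrt ((1 - x) * (1 - y))))"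

definition circle_param :: "real \<Rightarrow> real \<times> real" where
  "circle_param t = ((1 - t\<^sup>2) / (1 + t\<^sup>2), 2 * t / (1 + t\<^sup>2))"

text \<open>\<^const>\<open>circle_map\<close> sends the parameters 1/3 and 1/2 to the endpoints (0,1) and (1,0) of the
  closed quarter circle, so the inverse of \<^const>\<open>circle_param\<close> is taken on [0,1]; on the open
  quarter circle it agrees with the inverse of the restriction to (0,1).\<close>

definition interval_map :: "real \<Rightarrow> real" where
  "interval_map = inv_into {0..1} circle_param \<circ> circle_map \<circ> circle_param"

text \<open>Since ds = 2 dt / (1 + t^2), the density of \<^const>\<open>circle_measure\<close> in the parameter t is
  sqrt 2 / (t (1 - t)), twice the density below; hence conjugacy holds with the constant 1/2.\<close>

definition unit_interval_measure :: "real measure" where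
  "unit_interval_measure =
     density (restrict_space lborel {0<..<1})
       (\<lambda>t. ennreal (1 / sqrt 2 * (1 / (t * (1 - t)))))"

lemma space_circle_measure: "space circle_measure = quarter_circle"
  by (simp add: circle_measure_def circle_arc_length_def space_restrict_space)

lemma space_unit_interval_measure: "space unit_interval_measure = {0<..<1}"
  by (simp add: unit_interval_measure_def space_restrict_space)

text \<open>The measures here are infinite, and the map is allowed to leave the space on a null set.\<close>

definition measure_preserving_system :: "'a measure \<Rightarrow> ('a \<Rightarrow> 'a) \<Rightarrow> bool" where
  "measure_preserving_system M S \<longleftrightarrow>
     (AE x in M. S x \<in> space M) \<and>
     (\<forall>A\<in>sets M. S -` A \<inter> space M \<in> sets M \<and>
        emeasure M (S -` A \<inter> space M) = emeasure M A)"

text \<open>For infinite measures, conjugacy is understood up to a multiplicative constant, since there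
  is no canonical normalization; the constant \<open>c\<close> is made explicit.\<close>

definition conjugate_by ::
  "('a \<Rightarrow> 'b) \<Rightarrow> ennreal \<Rightarrow> 'a measure \<Rightarrow> ('a \<Rightarrow> 'a) \<Rightarrow> 'b measure \<Rightarrow> ('b \<Rightarrow> 'b) \<Rightarrow> bool" where
  "conjugate_by \<phi> c M S N R \<longleftrightarrow>
     bij_betw \<phi> (space M) (space N) \<and>
     \<phi> \<in> measurable M N \<and>
     inv_into (space M) \<phi> \<in> measurable N M \<and>
     (\<forall>x\<in>space M. \<phi> (S x) = R (\<phi> x)) \<and>
     distr M N \<phi> = scale_measure c N"

definition slow_euclid :: "real \<times> real \<Rightarrow> real \<times> real" where
  "slow_euclid = (\<lambda>(x, y).
     if x - 2 * y > y then (x - 2 * y, y)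
     else if x - 2 * y > 0 then (y, x - 2 * y)
     else (y, 2 * y - x))"

definition ratio :: "real \<times> real \<Rightarrow> real" where
  "ratio = (\<lambda>(x, y). y / x)"

definition scaling_of :: "(real \<times> real \<Rightarrow> real \<times> real) \<Rightarrow> (real \<Rightarrow> real) \<Rightarrow> bool" where
  "scaling_of E f \<longleftrightarrow> (\<forall>x y. 0 < y \<and> y < x \<longrightarrow> ratio (E (x, y)) = f (ratio (x, y)))"

end

theory Submission
  imports Defs
begin

text \<open>
  The parameter \<open>t\<close> of a point \<open>(x, y)\<close> of the unit circle is the slope \<open>y / (1 + x)\<close> of the line that
  joins it to \<open>(-1, 0)\<close>, so \<^const>\<open>circle_param\<close> is injective with an explicit rational inverse.
  Substituting the parametrization into \<^const>\<open>circle_map\<close> cancels the factor \<open>1 + t\<^sup>2\<close> and leaves the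
  parametrization of \<open>a / b\<close>, where \<open>a = t\<close>, \<open>b = 1 - 2 * t\<close> for \<open>t < 1/3\<close> and \<open>a = \<bar>1 - 2 * t\<bar>\<close>,
  \<open>b = t\<close> otherwise (\<open>circle_map_circle_param_eq\<close>). These quotients are the ratios of the pairs that one
  step of the slow Euclidean algorithm produces from a pair of ratio \<open>t\<close>, which gives the formulas
  for \<^const>\<open>interval_map\<close> and its interpretation as a scaling.

  The measure on the interval is invariant because of a telescoping sum. The map has three inverse
  branches, \<open>s / (1 + 2 * s)\<close>, \<open>1 / (2 + s)\<close> and \<open>1 / (2 - s)\<close>, each smooth on \<open>[0, 1]\<close>, with images
  \<open>[0, 1/3]\<close>, \<open>[1/3, 1/2]\<close> and \<open>[1/2, 1]\<close>. Pulling the density \<open>1 / (t * (1 - t))\<close> back along them gives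
  \<open>1 / s - 1 / (1 + s)\<close>, \<open>1 / (1 + s)\<close> and \<open>1 / (1 - s)\<close>, whose sum is the same density
  \<open>1 / s + 1 / (1 - s)\<close> (\<open>nn_integral_slow_ratio_map\<close>).

  On the circle, \<open>\<theta> = 2 * arctan t\<close> turns arc length into \<open>2 dt / (1 + t\<^sup>2)\<close>, while \<open>1 - x\<close> and \<open>1 - y\<close>
  become \<open>2 * t\<^sup>2 / (1 + t\<^sup>2)\<close> and \<open>(1 - t)\<^sup>2 / (1 + t\<^sup>2)\<close>; hence the measure on the circle is twice the image
  of the one on the interval (\<open>emeasure_circle_measure\<close>), and invariance is carried over by
  conjugacy (\<open>measure_preserving_system_conjugate\<close>).
\<close>

section \<open>The rational parametrization of the quarter circle\<close>

text \<open>Stereographic projection from \<open>(-1, 0)\<close>, the inverse of \<^const>\<open>circle_param\<close>.\<close>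

definition slope_through_pole :: "real \<times> real \<Rightarrow> real" where
  "slope_through_pole = (\<lambda>(x, y). y / (1 + x))"

lemma slope_through_pole_circle_param [simp]: "slope_through_pole (circle_param t) = t"
proof -
  have p: "1 + t\<^sup>2 > 0"
    by (simp add: add_pos_nonneg)
  have "1 + (1 - t\<^sup>2) / (1 + t\<^sup>2) = 2 / (1 + t\<^sup>2)"
    using p by (simp add: field_simps)
  then show ?thesis
    using p by (simp add: slope_through_pole_def circle_param_def)
qed

lemma circle_param_slope_through_pole:
  assumes "x\<^sup>2 + y\<^sup>2 = 1" and "x > -1"
  shows "circle_param (slope_through_pole (x, y)) = (x, y)"
proof -
  have q: "1 + x > 0"
    using assms by simp
  have y2: "y\<^sup>2 = (1 - x) * (1 + x)"
    using assms(1) by (simp add: algebra_simps power2_eq_square)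
  have "(y / (1 + x))\<^sup>2 = (1 - x) / (1 + x)"
    using q by (simp add: power_divide y2) (simp add: power2_eq_square)
  moreover have "1 + (1 - x) / (1 + x) = 2 / (1 + x)" "1 - (1 - x) / (1 + x) = 2 * x / (1 + x)"
    using q by (simp_all add: field_simps)
  ultimately show ?thesis
    using q by (simp add: circle_param_def slope_through_pole_def)
qed

lemma circle_param_on_unit_circle:
  "fst (circle_param t) ^ 2 + snd (circle_param t) ^ 2 = 1"
proof -
  have p: "1 + t\<^sup>2 > 0"
    by (simp add: add_pos_nonneg)
  have "(1 - t\<^sup>2)\<^sup>2 + (2 * t)\<^sup>2 = (1 + t\<^sup>2)\<^sup>2"
    by (simp add: power2_eq_square algebra_simps)
  then show ?thesis
    using p by (simp add: circle_param_def power_divide add_divide_distrib [symmetric])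
qed

lemma circle_param_in_quarter_circle_iff:
  "circle_param t \<in> quarter_circle \<longleftrightarrow> 0 < t \<and> t < 1"
proof -
  have p: "1 + t\<^sup>2 > 0"
    by (simp add: add_pos_nonneg)
  have "t\<^sup>2 < 1 \<longleftrightarrow> t < 1" if "0 < t"
    using that by (simp add: power_less_one_iff)
  then show ?thesis
    using p circle_param_on_unit_circle [of t]
    by (auto simp: quarter_circle_def circle_param_def zero_less_divide_iff)
qed

lemma inj_circle_param: "inj_on circle_param S"
  by (rule inj_on_inverseI [of _ slope_through_pole]) simp

lemma bij_betw_circle_param_quarter_circle: "bij_betw circle_param {0<..<1} quarter_circle"
proof (rule bij_betw_imageI [OF inj_circle_param])
  have "p \<in> circle_param ` {0<..<1}" if "p \<in> quarter_circle" for p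
  proof -
    have "circle_param (slope_through_pole p) = p"
      using that by (cases p) (auto simp: quarter_circle_def intro!: circle_param_slope_through_pole)
    then show ?thesis
      using that circle_param_in_quarter_circle_iff [of "slope_through_pole p"]
      by (metis greaterThanLessThan_iff imageI)
  qed
  then show "circle_param ` {0<..<1} = quarter_circle"
    by (auto simp: circle_param_in_quarter_circle_iff)
qed

lemma continuous_on_circle_param: "continuous_on S circle_param"
proof -
  have "1 + t\<^sup>2 \<noteq> 0" for t :: real
    using add_pos_nonneg [of 1 "t\<^sup>2"] by auto
  then show ?thesis
    unfolding circle_param_def by (intro continuous_intros) auto
qed

text \<open>The image of the compact interval is closed, and it lies in the closure of the image of the
  dense open interval.\<close>

lemma circle_param_image_closed_interval: "circle_param ` {0..1} = closure quarter_circle"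
proof (rule antisym)
  have Q: "quarter_circle = circle_param ` {0<..<1}"
    using bij_betw_circle_param_quarter_circle by (simp add: bij_betw_def)
  show "circle_param ` {0..1} \<subseteq> closure quarter_circle"
    using image_closure_subset [OF continuous_on_circle_param closed_closure, of "{0<..<1}" quarter_circle]
      closure_subset [of quarter_circle]
    by (simp add: Q)
  have "closed (circle_param ` {0..1})"
    by (intro compact_imp_closed compact_continuous_image continuous_on_circle_param compact_Icc)
  then show "closure quarter_circle \<subseteq> circle_param ` {0..1}"
    by (intro closure_minimal) (auto simp: Q)
qed

lemma bij_betw_circle_param_closure: "bij_betw circle_param {0..1} (closure quarter_circle)"
  by (rule bij_betw_imageI [OF inj_circle_param circle_param_image_closed_interval])


section \<open>The circle map in the parameter\<close>

text \<open>The closed form of \<^const>\<open>interval_map\<close> on \<open>(0, 1)\<close>. The absolute value merges the branches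
  \<open>1 / t - 2\<close> and \<open>2 - 1 / t\<close>, so that the values at the breakpoints \<open>1/3\<close> and \<open>1/2\<close>, namely 1 and 0,
  are the right ones too.\<close>

definition slow_ratio_map :: "real \<Rightarrow> real" where
  "slow_ratio_map t = (if t < 1 / 3 then t / (1 - 2 * t) else \<bar>1 / t - 2\<bar>)"

lemma slow_ratio_map_bounds:
  assumes "0 < t" and "t < 1"
  shows "0 \<le> slow_ratio_map t" and "slow_ratio_map t \<le> 1"
proof -
  have "1 / t > 1" "t \<ge> 1 / 3 \<Longrightarrow> 1 / t \<le> 3"
    using assms by (simp_all add: field_simps)
  then show "0 \<le> slow_ratio_map t" "slow_ratio_map t \<le> 1"
    using assms by (auto simp: slow_ratio_map_def abs_le_iff divide_simps)
qed

text \<open>The parametrization in homogeneous form, in which the values of \<^const>\<open>circle_map\<close> can be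
  recognized.\<close>

lemma circle_param_divide:
  assumes "b \<noteq> 0"
  shows "circle_param (a / b) = ((b\<^sup>2 - a\<^sup>2) / (b\<^sup>2 + a\<^sup>2), 2 * a * b / (b\<^sup>2 + a\<^sup>2))"
proof -
  have "b\<^sup>2 > 0" "b\<^sup>2 + a\<^sup>2 > 0"
    using assms by (simp_all add: add_pos_nonneg)
  then show ?thesis
    using assms unfolding circle_param_def power_divide
    by (simp add: divide_simps power2_eq_square)
qed

lemma circle_map_circle_param:
  "circle_map (circle_param t) =
     (\<bar>(1 - t) * (1 - 3 * t)\<bar> / ((1 - 2 * t)\<^sup>2 + t\<^sup>2), \<bar>2 * t * (1 - 2 * t)\<bar> / ((1 - 2 * t)\<^sup>2 + t\<^sup>2))"
proof -
  let ?q = "1 + t\<^sup>2" and ?x = "fst (circle_param t)" and ?y = "snd (circle_param t)"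
  have q: "?q > 0"
    by (simp add: add_pos_nonneg)
  have "2 - ?x - 2 * ?y = (1 - t) * (1 - 3 * t) / ?q"
    "2 - 2 * ?x - ?y = - (2 * t * (1 - 2 * t)) / ?q"
    "3 - 2 * ?x - 2 * ?y = ((1 - 2 * t)\<^sup>2 + t\<^sup>2) / ?q"
    using q by (simp_all add: circle_param_def divide_simps power2_eq_square; simp add: algebra_simps)+
  then show ?thesis
    using q by (simp add: circle_map_def case_prod_beta abs_divide abs_minus_cancel)
qed

text \<open>With \<open>a = t\<close> and \<open>b = 1 - 2 * t\<close> the two numerators are \<open>\<bar>b\<^sup>2 - a\<^sup>2\<bar>\<close> and \<open>\<bar>2 * a * b\<bar>\<close>. The sign of
  \<open>b\<^sup>2 - a\<^sup>2 = (1 - t) * (1 - 3 * t)\<close> decides which of \<open>a / b\<close> and \<open>\<bar>b\<bar> / a\<close> is the parameter of the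
  image; this is why the map breaks at \<open>1/3\<close>.\<close>

lemma circle_map_circle_param_eq:
  assumes "0 < t" and "t < 1"
  shows "circle_map (circle_param t) = circle_param (slow_ratio_map t)"
proof (cases "t < 1 / 3")
  case True
  then have "circle_param (slow_ratio_map t) =
      (((1 - 2 * t)\<^sup>2 - t\<^sup>2) / ((1 - 2 * t)\<^sup>2 + t\<^sup>2), 2 * t * (1 - 2 * t) / ((1 - 2 * t)\<^sup>2 + t\<^sup>2))"
    by (simp add: slow_ratio_map_def circle_param_divide)
  moreover have "(1 - 2 * t)\<^sup>2 - t\<^sup>2 = \<bar>(1 - t) * (1 - 3 * t)\<bar>"
    using True assms by (simp add: abs_mult) (simp add: power2_eq_square algebra_simps)
  moreover have "2 * t * (1 - 2 * t) = \<bar>2 * t * (1 - 2 * t)\<bar>"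
    using True assms by simp
  ultimately show ?thesis
    by (simp add: circle_map_circle_param)
next
  case False
  have "slow_ratio_map t = \<bar>1 - 2 * t\<bar> / t"
    using False assms by (simp add: slow_ratio_map_def abs_if divide_simps)
  then have "circle_param (slow_ratio_map t) =
      ((t\<^sup>2 - (1 - 2 * t)\<^sup>2) / ((1 - 2 * t)\<^sup>2 + t\<^sup>2), 2 * \<bar>1 - 2 * t\<bar> * t / ((1 - 2 * t)\<^sup>2 + t\<^sup>2))"
    using assms by (simp add: circle_param_divide add.commute)
  moreover have "t\<^sup>2 - (1 - 2 * t)\<^sup>2 = \<bar>(1 - t) * (1 - 3 * t)\<bar>"
    using False assms by (simp add: abs_mult) (simp add: power2_eq_square algebra_simps)
  moreover have "2 * \<bar>1 - 2 * t\<bar> * t = \<bar>2 * t * (1 - 2 * t)\<bar>"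
    using assms by (simp add: abs_mult)
  ultimately show ?thesis
    by (simp add: circle_map_circle_param)
qed

lemma interval_map_eq:
  assumes "0 < t" and "t < 1"
  shows "interval_map t = slow_ratio_map t"
  using assms slow_ratio_map_bounds [OF assms]
  by (simp add: interval_map_def circle_map_circle_param_eq inv_into_f_f [OF inj_circle_param])

lemma circle_param_interval_map:
  assumes "0 < t" and "t < 1"
  shows "circle_param (interval_map t) = circle_map (circle_param t)"
  using assms by (simp add: interval_map_eq circle_map_circle_param_eq)

lemma circle_map_image: "circle_map ` quarter_circle \<subseteq> closure quarter_circle"
proof -
  have "circle_map (circle_param t) \<in> circle_param ` {0..1}" if "t \<in> {0<..<1}" for t
    using that slow_ratio_map_bounds [of t] by (simp add: circle_map_circle_param_eq)
  then have "circle_map ` circle_param ` {0<..<1} \<subseteq> circle_param ` {0..1}"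
    by blast
  then show ?thesis
    by (simp only: circle_param_image_closed_interval bij_betw_imp_surj_on [OF bij_betw_circle_param_quarter_circle])
qed

lemma scaling_of_slow_euclid: "scaling_of slow_euclid interval_map"
proof -
  have "ratio (slow_euclid (x, y)) = slow_ratio_map (y / x)" if "0 < y" "y < x" for x y
  proof -
    have "y / x < 1 / 3 \<longleftrightarrow> x - 2 * y > y" "x / y - 2 \<ge> 0 \<longleftrightarrow> x - 2 * y \<ge> 0"
      using that by (auto simp: field_simps)
    moreover have "y / x / (1 - 2 * (y / x)) = y / (x - 2 * y)" if "x - 2 * y > y"
      using that \<open>0 < y\<close> \<open>y < x\<close> by (simp add: field_simps)
    ultimately show ?thesis
      using that by (auto simp: slow_euclid_def ratio_def slow_ratio_map_def abs_if diff_divide_distrib)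
  qed
  then show ?thesis
    by (simp add: scaling_of_def ratio_def interval_map_eq)
qed


section \<open>Invariance of the measure on the interval\<close>

lemma sets_unit_interval_measure:
  "A \<in> sets unit_interval_measure \<longleftrightarrow> A \<subseteq> {0<..<1} \<and> A \<in> sets borel"
  by (simp add: unit_interval_measure_def sets_restrict_space_iff)

lemma emeasure_unit_interval_measure:
  assumes "A \<in> sets unit_interval_measure"
  shows "emeasure unit_interval_measure A =
    (\<integral>\<^sup>+t. ennreal (1 / sqrt 2 * (1 / (t * (1 - t)))) * indicator A t \<partial>lborel)"
proof -
  have A: "A \<subseteq> {0<..<1}" "A \<in> sets (restrict_space lborel {0<..<1})"
    using assms by (auto simp: sets_unit_interval_measure sets_restrict_space_iff)
  have "emeasure unit_interval_measure A =
    (\<integral>\<^sup>+t. ennreal (1 / sqrt 2 * (1 / (t * (1 - t)))) * indicator A t * indicator {0<..<1} t \<partial>lborel)"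
    unfolding unit_interval_measure_def
    by (subst emeasure_density[OF measurable_restrict_space1 A(2)]) (simp_all add: nn_integral_restrict_space)
  also have "\<dots> = (\<integral>\<^sup>+t. ennreal (1 / sqrt 2 * (1 / (t * (1 - t)))) * indicator A t \<partial>lborel)"
    using A(1) by (intro nn_integral_cong) (auto simp: indicator_def)
  finally show ?thesis .
qed

lemma borel_measurable_slow_ratio_map [measurable]: "slow_ratio_map \<in> borel_measurable borel"
  unfolding slow_ratio_map_def by measurable

text \<open>The reflection \<open>x \<mapsto> - x\<close> reduces the decreasing substitution \<open>g\<close> to the increasing one \<open>- g\<close>.\<close>

lemma nn_integral_substitution_decreasing:
  fixes f :: "real \<Rightarrow> ennreal"
  assumes [measurable]: "f \<in> borel_measurable borel"
    and "\<And>x. x \<in> {a..b} \<Longrightarrow> (g has_real_derivative - g' x) (at x)"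
    and "continuous_on {a..b} g'"
    and "\<And>x. x \<in> {a..b} \<Longrightarrow> 0 \<le> g' x"
    and "a < b"
  shows "(\<integral>\<^sup>+x. f x * indicator {g b..g a} x \<partial>lborel) =
    (\<integral>\<^sup>+x. f (g x) * g' x * indicator {a..b} x \<partial>lborel)"
proof -
  have "(\<integral>\<^sup>+x. f x * indicator {g b..g a} x \<partial>lborel) =
      (\<integral>\<^sup>+x. f (- x) * indicator {g b..g a} (- x) \<partial>lborel)"
    by (subst nn_integral_real_affine [where c = "-1" and t = 0]) simp_all
  also have "\<dots> = (\<integral>\<^sup>+x. f (- x) * indicator {- g a..- g b} x \<partial>lborel)"
    by (intro nn_integral_cong) (auto simp: indicator_def)
  also have "\<dots> = (\<integral>\<^sup>+x. f (- (- g x)) * g' x * indicator {a..b} x \<partial>lborel)"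
    using assms by (intro nn_integral_substitution_aux) (auto intro!: derivative_eq_intros)
  finally show ?thesis
    by simp
qed

text \<open>Splitting the left-hand integral at \<open>1/3\<close> and \<open>1/2\<close> and substituting the inverse branch on each
  piece gives three integrals over \<open>A\<close>, and their densities telescope to the original one.\<close>

lemma nn_integral_slow_ratio_map:
  assumes A: "A \<in> sets unit_interval_measure"
  defines "h \<equiv> \<lambda>t. ennreal (1 / sqrt 2 * (1 / (t * (1 - t))))"
  shows "(\<integral>\<^sup>+t. h t * indicator (slow_ratio_map -` A \<inter> {0<..<1}) t \<partial>lborel) =
    (\<integral>\<^sup>+s. h s * indicator A s \<partial>lborel)"
proof -
  have [measurable]: "A \<in> sets borel" and A01: "\<And>s. s \<in> A \<Longrightarrow> 0 < s \<and> s < 1"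
    using A by (auto simp: sets_unit_interval_measure)
  have [measurable]: "h \<in> borel_measurable borel"
    unfolding h_def by measurable
  define f where "f t = h t * indicator A (slow_ratio_map t) * indicator {0<..<1} t" for t
  have [measurable]: "f \<in> borel_measurable borel"
    unfolding f_def by measurable
  (* The pointwise form of one substitution: u is the value at s of an inverse branch, d the
     absolute value of its derivative there, and k the pulled-back density. *)
  have branch: "f u * ennreal d * indicator {0..1} s = ennreal (1 / sqrt 2 * k) * indicator A s"
    if F: "0 \<le> s \<Longrightarrow> s \<le> 1 \<Longrightarrow> slow_ratio_map u = s"
      and k: "0 < s \<Longrightarrow> s < 1 \<Longrightarrow> 0 < u \<and> u < 1 \<and> 1 / (u * (1 - u)) * d = k"
      and d: "0 \<le> d" for u d k s
  proof (cases "s \<in> A")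
    case True
    then have s: "0 < s" "s < 1"
      using A01 by auto
    have "1 / sqrt 2 * k = 1 / sqrt 2 * (1 / (u * (1 - u))) * d"
      using k [OF s] by (simp only: mult.assoc)
    then have "ennreal (1 / sqrt 2 * k) = h u * ennreal d"
      by (simp only: h_def ennreal_mult'' [OF d])
    then show ?thesis
      using s True F k [OF s] by (simp add: f_def)
  next
    case False
    then show ?thesis
      using F by (auto simp: f_def indicator_def)
  qed
  have left: "(\<integral>\<^sup>+t. f t * indicator {0..1/3} t \<partial>lborel) =
      (\<integral>\<^sup>+s. ennreal (1 / sqrt 2 * (1 / s - 1 / (1 + s))) * indicator A s \<partial>lborel)"
  proof -
    have "(\<integral>\<^sup>+t. f t * indicator {0 / (1 + 2 * 0)..1 / (1 + 2 * 1)} t \<partial>lborel) =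
        (\<integral>\<^sup>+s. f (s / (1 + 2 * s)) * ennreal (1 / (1 + 2 * s)\<^sup>2) * indicator {0..1} s \<partial>lborel)"
      by (intro nn_integral_substitution_aux)
        (auto intro!: derivative_eq_intros continuous_intros simp: power2_eq_square divide_simps)
    also have "\<dots> = (\<integral>\<^sup>+s. ennreal (1 / sqrt 2 * (1 / s - 1 / (1 + s))) * indicator A s \<partial>lborel)"
    proof (intro nn_integral_cong branch)
      fix s :: real
      show "slow_ratio_map (s / (1 + 2 * s)) = s" if "0 \<le> s" "s \<le> 1"
        using that by (auto simp: slow_ratio_map_def divide_simps)
      assume s: "0 < s" "s < 1"
      have "1 - s / (1 + 2 * s) = (1 + s) / (1 + 2 * s)"
        using s by (simp add: field_simps)
      then show "0 < s / (1 + 2 * s) \<and> s / (1 + 2 * s) < 1 \<and>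
          1 / (s / (1 + 2 * s) * (1 - s / (1 + 2 * s))) * (1 / (1 + 2 * s)\<^sup>2) = 1 / s - 1 / (1 + s)"
        using s by (simp add: power2_eq_square divide_simps)
    qed simp
    finally show ?thesis
      by simp
  qed
  have middle: "(\<integral>\<^sup>+t. f t * indicator {1/3..1/2} t \<partial>lborel) =
      (\<integral>\<^sup>+s. ennreal (1 / sqrt 2 * (1 / (1 + s))) * indicator A s \<partial>lborel)"
  proof -
    have "(\<integral>\<^sup>+t. f t * indicator {1 / (2 + 1)..1 / (2 + 0)} t \<partial>lborel) =
        (\<integral>\<^sup>+s. f (1 / (2 + s)) * ennreal (1 / (2 + s)\<^sup>2) * indicator {0..1} s \<partial>lborel)"
      by (intro nn_integral_substitution_decreasing)
        (auto intro!: derivative_eq_intros continuous_intros simp: power2_eq_square divide_simps)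
    also have "\<dots> = (\<integral>\<^sup>+s. ennreal (1 / sqrt 2 * (1 / (1 + s))) * indicator A s \<partial>lborel)"
    proof (intro nn_integral_cong branch)
      fix s :: real
      show "slow_ratio_map (1 / (2 + s)) = s" if "0 \<le> s" "s \<le> 1"
        using that by (auto simp: slow_ratio_map_def divide_simps)
      assume s: "0 < s" "s < 1"
      have "1 - 1 / (2 + s) = (1 + s) / (2 + s)"
        using s by (simp add: field_simps)
      then show "0 < 1 / (2 + s) \<and> 1 / (2 + s) < 1 \<and>
          1 / (1 / (2 + s) * (1 - 1 / (2 + s))) * (1 / (2 + s)\<^sup>2) = 1 / (1 + s)"
        using s by (simp add: power2_eq_square divide_simps)
    qed simp
    finally show ?thesis
      by simp
  qed
  have right: "(\<integral>\<^sup>+t. f t * indicator {1/2..1} t \<partial>lborel) =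
      (\<integral>\<^sup>+s. ennreal (1 / sqrt 2 * (1 / (1 - s))) * indicator A s \<partial>lborel)"
  proof -
    have "(\<integral>\<^sup>+t. f t * indicator {1 / (2 - 0)..1 / (2 - 1)} t \<partial>lborel) =
        (\<integral>\<^sup>+s. f (1 / (2 - s)) * ennreal (1 / (2 - s)\<^sup>2) * indicator {0..1} s \<partial>lborel)"
      by (intro nn_integral_substitution_aux)
        (auto intro!: derivative_eq_intros continuous_intros simp: power2_eq_square divide_simps)
    also have "\<dots> = (\<integral>\<^sup>+s. ennreal (1 / sqrt 2 * (1 / (1 - s))) * indicator A s \<partial>lborel)"
    proof (intro nn_integral_cong branch)
      fix s :: real
      show "slow_ratio_map (1 / (2 - s)) = s" if "0 \<le> s" "s \<le> 1"
        using that by (auto simp: slow_ratio_map_def divide_simps)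
      assume s: "0 < s" "s < 1"
      have "1 - 1 / (2 - s) = (1 - s) / (2 - s)"
        using s by (simp add: field_simps)
      then show "0 < 1 / (2 - s) \<and> 1 / (2 - s) < 1 \<and>
          1 / (1 / (2 - s) * (1 - 1 / (2 - s))) * (1 / (2 - s)\<^sup>2) = 1 / (1 - s)"
        using s by (simp add: power2_eq_square divide_simps)
    qed simp
    finally show ?thesis
      by simp
  qed
  (* The breakpoints, which the three closed pieces share, go to 1 and 0 and hence outside A. *)
  have "f (1 / 3) = 0" "f (1 / 2) = 0"
    using A01 [of 1] A01 [of 0] by (auto simp: f_def slow_ratio_map_def indicator_def)
  then have pieces: "f t = f t * indicator {0..1/3} t + f t * indicator {1/3..1/2} t + f t * indicator {1/2..1} t" for t
  proof (cases "t = 1 / 3 \<or> t = 1 / 2")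
    case True
    then have "f t = 0"
      using \<open>f (1 / 3) = 0\<close> \<open>f (1 / 2) = 0\<close> by blast
    then show ?thesis
      by simp
  next
    case False
    then show ?thesis
      by (auto simp: f_def indicator_def)
  qed
  have "(\<integral>\<^sup>+t. h t * indicator (slow_ratio_map -` A \<inter> {0<..<1}) t \<partial>lborel) = (\<integral>\<^sup>+t. f t \<partial>lborel)"
    by (intro nn_integral_cong) (auto simp: f_def indicator_def)
  also have "\<dots> = (\<integral>\<^sup>+t. f t * indicator {0..1/3} t + f t * indicator {1/3..1/2} t
      + f t * indicator {1/2..1} t \<partial>lborel)"
    by (intro nn_integral_cong pieces)
  also have "\<dots> = (\<integral>\<^sup>+t. f t * indicator {0..1/3} t \<partial>lborel)
      + (\<integral>\<^sup>+t. f t * indicator {1/3..1/2} t \<partial>lborel) + (\<integral>\<^sup>+t. f t * indicator {1/2..1} t \<partial>lborel)"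
    by (simp add: nn_integral_add)
  also have "\<dots> = (\<integral>\<^sup>+s. ennreal (1 / sqrt 2 * (1 / s - 1 / (1 + s))) * indicator A s
      + ennreal (1 / sqrt 2 * (1 / (1 + s))) * indicator A s
      + ennreal (1 / sqrt 2 * (1 / (1 - s))) * indicator A s \<partial>lborel)"
    unfolding left middle right by (simp add: nn_integral_add)
  also have "\<dots> = (\<integral>\<^sup>+s. h s * indicator A s \<partial>lborel)"
  proof (intro nn_integral_cong)
    fix s :: real
    have factor: "ennreal (r * a) + ennreal (r * b) + ennreal (r * c) = ennreal (r * (a + b + c))"
      if "0 \<le> r" "0 \<le> a" "0 \<le> b" "0 \<le> c" for r a b c
      using that by (simp add: distrib_left)
    have "ennreal (1 / sqrt 2 * (1 / s - 1 / (1 + s))) + ennreal (1 / sqrt 2 * (1 / (1 + s)))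
        + ennreal (1 / sqrt 2 * (1 / (1 - s))) = h s" if "s \<in> A"
    proof -
      have s: "0 < s" "s < 1"
        using A01 [OF that] by auto
      have "1 / s - 1 / (1 + s) \<ge> 0"
        using s by (simp add: field_simps)
      then have "ennreal (1 / sqrt 2 * (1 / s - 1 / (1 + s))) + ennreal (1 / sqrt 2 * (1 / (1 + s)))
          + ennreal (1 / sqrt 2 * (1 / (1 - s)))
          = ennreal (1 / sqrt 2 * ((1 / s - 1 / (1 + s)) + 1 / (1 + s) + 1 / (1 - s)))"
        using s by (intro factor) simp_all
      also have "(1 / s - 1 / (1 + s)) + 1 / (1 + s) + 1 / (1 - s) = 1 / (s * (1 - s))"
        using s by (simp add: divide_simps)
      finally show ?thesis
        by (simp add: h_def)
    qed
    then show "ennreal (1 / sqrt 2 * (1 / s - 1 / (1 + s))) * indicator A s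
      + ennreal (1 / sqrt 2 * (1 / (1 + s))) * indicator A s
      + ennreal (1 / sqrt 2 * (1 / (1 - s))) * indicator A s = h s * indicator A s"
      by (simp add: indicator_def)
  qed
  finally show ?thesis .
qed

lemma measure_preserving_interval_map: "measure_preserving_system unit_interval_measure interval_map"
proof -
  have pre: "interval_map -` A \<inter> {0<..<1} = slow_ratio_map -` A \<inter> {0<..<1}" for A
    by (auto simp: interval_map_eq)
  have meas: "slow_ratio_map -` A \<inter> {0<..<1} \<in> sets unit_interval_measure"
    if "A \<in> sets unit_interval_measure" for A
  proof -
    have [measurable]: "A \<in> sets borel"
      using that by (simp add: sets_unit_interval_measure)
    have "slow_ratio_map -` A \<inter> space borel \<in> sets borel"
      by measurable
    then show ?thesis
      by (auto simp: sets_unit_interval_measure)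
  qed
  (* Only the breakpoints leave the open interval. *)
  have "AE t in lborel. t \<noteq> 1 / 3 \<and> t \<noteq> (1 / 2 :: real)"
    using AE_lborel_singleton [of "1 / 3 :: real"] AE_lborel_singleton [of "1 / 2 :: real"]
    by eventually_elim simp
  moreover have "0 < slow_ratio_map t \<and> slow_ratio_map t < 1"
    if "0 < t" "t < 1" "t \<noteq> 1 / 3" "t \<noteq> 1 / 2" for t
  proof -
    have "1 / t > 1" "1 / t \<noteq> 2" "t > 1 / 3 \<Longrightarrow> 1 / t < 3"
      using that by (simp_all add: field_simps)
    then show ?thesis
      using that by (auto simp: slow_ratio_map_def divide_simps)
  qed
  ultimately have "AE t in lborel. t \<in> {0<..<1} \<longrightarrow> interval_map t \<in> {0<..<1}"
    by (auto simp: interval_map_eq)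
  then have "AE t in unit_interval_measure. interval_map t \<in> {0<..<1}"
    unfolding unit_interval_measure_def
    by (subst AE_density) (auto simp: AE_restrict_space_iff intro!: measurable_restrict_space1)
  moreover have "emeasure unit_interval_measure (slow_ratio_map -` A \<inter> {0<..<1}) = emeasure unit_interval_measure A"
    if "A \<in> sets unit_interval_measure" for A
    by (simp only: emeasure_unit_interval_measure [OF meas [OF that]] emeasure_unit_interval_measure [OF that]
        nn_integral_slow_ratio_map [OF that])
  ultimately show ?thesis
    by (simp add: measure_preserving_system_def space_unit_interval_measure pre meas)
qed


section \<open>Transfer to the circle\<close>

lemma borel_quarter_circle [measurable]: "quarter_circle \<in> sets borel"
proof -
  have "quarter_circle = {p. 0 < fst p} \<inter> {p. 0 < snd p} \<inter> {p. fst p ^ 2 + snd p ^ 2 = 1}"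
    by (auto simp: quarter_circle_def)
  also have "\<dots> \<in> sets borel"
    by (intro sets.Int borel_open borel_closed open_Collect_less closed_Collect_eq continuous_intros)
  finally show ?thesis .
qed

lemma sets_circle_measure:
  "B \<in> sets circle_measure \<longleftrightarrow> B \<subseteq> quarter_circle \<and> B \<in> sets borel"
  by (simp add: circle_measure_def circle_arc_length_def sets_restrict_space_iff)

lemma emeasure_circle_measure_angle:
  assumes "B \<in> sets circle_measure"
  shows "emeasure circle_measure B =
    (\<integral>\<^sup>+\<theta>. ennreal (1 / sqrt ((1 - cos \<theta>) * (1 - sin \<theta>))) * indicator B (cos \<theta>, sin \<theta>)
       * indicator {0..pi / 2} \<theta> \<partial>lborel)"
proof -
  have B: "B \<subseteq> quarter_circle" and [measurable]: "B \<in> sets borel"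
    using assms by (auto simp: sets_circle_measure)
  have BR: "B \<in> sets (restrict_space circle_arc_length quarter_circle)"
    using assms by (simp add: circle_measure_def)
  define w :: "real \<times> real \<Rightarrow> ennreal" where
    "w = (\<lambda>(x, y). ennreal (1 / sqrt ((1 - x) * (1 - y))))"
  have [measurable]: "w \<in> borel_measurable borel"
    unfolding w_def borel_prod [symmetric] by measurable
  have w_arc: "w \<in> borel_measurable circle_arc_length"
    by (simp add: circle_arc_length_def)
  have [measurable]: "(\<lambda>\<theta>. (cos \<theta>, sin \<theta>)) \<in> borel_measurable (borel :: real measure)"
    by (intro borel_measurable_continuous_onI continuous_intros)
  have quadrant: "\<theta> \<le> pi / 2" if "0 \<le> \<theta>" "\<theta> < 2 * pi" "(cos \<theta>, sin \<theta>) \<in> B" for \<theta>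
  proof -
    have pos: "cos \<theta> > 0" "sin \<theta> > 0"
      using B that(3) by (auto simp: quarter_circle_def)
    then have "\<theta> < pi"
      using sin_le_zero [of \<theta>] that by fastforce
    then show ?thesis
      using cos_monotone_0_pi_le [of "pi / 2" \<theta>] pos by fastforce
  qed
  have "emeasure circle_measure B =
      (\<integral>\<^sup>+p. w p * indicator B p \<partial>restrict_space circle_arc_length quarter_circle)"
    unfolding circle_measure_def w_def [symmetric]
    by (intro emeasure_density measurable_restrict_space1 w_arc BR)
  also have "\<dots> = (\<integral>\<^sup>+p. w p * indicator B p * indicator quarter_circle p \<partial>circle_arc_length)"
    by (intro nn_integral_restrict_space) (simp add: circle_arc_length_def)
  also have "\<dots> = (\<integral>\<^sup>+\<theta>. w (cos \<theta>, sin \<theta>) * indicator B (cos \<theta>, sin \<theta>)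
      * indicator quarter_circle (cos \<theta>, sin \<theta>) \<partial>restrict_space lborel {0..<2 * pi})"
    unfolding circle_arc_length_def by (intro nn_integral_distr measurable_restrict_space1) measurable
  also have "\<dots> = (\<integral>\<^sup>+\<theta>. w (cos \<theta>, sin \<theta>) * indicator B (cos \<theta>, sin \<theta>)
      * indicator quarter_circle (cos \<theta>, sin \<theta>) * indicator {0..<2 * pi} \<theta> \<partial>lborel)"
    by (intro nn_integral_restrict_space) simp
  also have "\<dots> = (\<integral>\<^sup>+\<theta>. ennreal (1 / sqrt ((1 - cos \<theta>) * (1 - sin \<theta>)))
      * indicator B (cos \<theta>, sin \<theta>) * indicator {0..pi / 2} \<theta> \<partial>lborel)"
  proof (intro nn_integral_cong)
    fix \<theta> :: real
    have "\<theta> \<in> {0..<2 * pi} \<longleftrightarrow> \<theta> \<in> {0..pi / 2}" if "(cos \<theta>, sin \<theta>) \<in> B"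
    proof -
      have "pi / 2 < 2 * pi"
        by simp
      then show ?thesis
        unfolding atLeastLessThan_iff atLeastAtMost_iff
        using quadrant [OF _ _ that] le_less_trans [of \<theta> "pi / 2" "2 * pi"] by blast
    qed
    then show "w (cos \<theta>, sin \<theta>) * indicator B (cos \<theta>, sin \<theta>)
        * indicator quarter_circle (cos \<theta>, sin \<theta>) * indicator {0..<2 * pi} \<theta>
      = ennreal (1 / sqrt ((1 - cos \<theta>) * (1 - sin \<theta>)))
        * indicator B (cos \<theta>, sin \<theta>) * indicator {0..pi / 2} \<theta>"
      using B by (cases "(cos \<theta>, sin \<theta>) \<in> B") (auto simp: w_def indicator_def)
  qed
  finally show ?thesis .
qed

lemma cos_sin_double_arctan: "(cos (2 * arctan t), sin (2 * arctan t)) = circle_param t"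
proof -
  have p: "1 + t\<^sup>2 > 0"
    by (simp add: add_pos_nonneg)
  then show ?thesis
    by (simp add: circle_param_def cos_double sin_double cos_arctan sin_arctan power_divide
        diff_divide_distrib)
qed

text \<open>Half-angle substitution \<open>\<theta> = 2 * arctan t\<close>. The factor 2 is the quotient of the two densities:
  \<open>sqrt ((1 - x) * (1 - y))\<close> is \<open>sqrt 2 * t * (1 - t) / (1 + t\<^sup>2)\<close>, so the density in \<open>t\<close> is
  \<open>2 / (sqrt 2 * t * (1 - t))\<close>.\<close>

lemma emeasure_circle_measure:
  assumes "B \<in> sets circle_measure"
  shows "emeasure circle_measure B =
    2 * emeasure unit_interval_measure (circle_param -` B \<inter> {0<..<1})"
proof -
  have B: "B \<subseteq> quarter_circle" and [measurable]: "B \<in> sets borel"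
    using assms by (auto simp: sets_circle_measure)
  have [measurable]: "circle_param \<in> borel_measurable borel"
    by (intro borel_measurable_continuous_onI continuous_on_circle_param)
  have [measurable]: "(\<lambda>\<theta>. (cos \<theta>, sin \<theta>)) \<in> borel_measurable (borel :: real measure)"
    by (intro borel_measurable_continuous_onI continuous_intros)
  have pre: "circle_param -` B \<inter> {0<..<1} \<in> sets unit_interval_measure"
    using measurable_sets [of circle_param borel borel B] by (simp add: sets_unit_interval_measure)
  define f where
    "f \<theta> = ennreal (1 / sqrt ((1 - cos \<theta>) * (1 - sin \<theta>))) * indicator B (cos \<theta>, sin \<theta>)" for \<theta>
  have [measurable]: "f \<in> borel_measurable borel"
    unfolding f_def by measurable
  have density: "1 / sqrt ((1 - fst (circle_param t)) * (1 - snd (circle_param t))) * (2 / (1 + t\<^sup>2))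
      = 2 * (1 / sqrt 2 * (1 / (t * (1 - t))))" if "0 < t" "t < 1" for t
  proof -
    have p: "1 + t\<^sup>2 > 0"
      by (simp add: add_pos_nonneg)
    have "1 - fst (circle_param t) = 2 * t\<^sup>2 / (1 + t\<^sup>2)" "1 - snd (circle_param t) = (1 - t)\<^sup>2 / (1 + t\<^sup>2)"
      using p by (simp_all add: circle_param_def divide_simps) (simp add: power2_eq_square algebra_simps)
    then have "(1 - fst (circle_param t)) * (1 - snd (circle_param t)) = 2 * (t * (1 - t) / (1 + t\<^sup>2))\<^sup>2"
      by (simp add: power2_eq_square)
    moreover have "t * (1 - t) > 0"
      using that by simp
    ultimately have root: "sqrt ((1 - fst (circle_param t)) * (1 - snd (circle_param t))) = sqrt 2 * (t * (1 - t) / (1 + t\<^sup>2))"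
      using p by (simp add: real_sqrt_mult)
    have cancel: "1 / (a * (b / q)) * (2 / q) = 2 * (1 / a * (1 / b))" if "q \<noteq> 0" for a b q :: real
      using that by simp
    show ?thesis
      using p by (simp only: root) (rule cancel, simp)
  qed
  have "emeasure circle_measure B = (\<integral>\<^sup>+\<theta>. f \<theta> * indicator {2 * arctan 0..2 * arctan 1} \<theta> \<partial>lborel)"
    using emeasure_circle_measure_angle [OF assms] by (simp add: f_def arctan_one)
  also have "\<dots> = (\<integral>\<^sup>+t. f (2 * arctan t) * ennreal (2 / (1 + t\<^sup>2)) * indicator {0..1} t \<partial>lborel)"
  proof (intro nn_integral_substitution_aux)
    have "1 + t\<^sup>2 \<noteq> 0" for t :: real
      using add_pos_nonneg [of 1 "t\<^sup>2"] by auto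
    then show "continuous_on {0..1} (\<lambda>t::real. 2 / (1 + t\<^sup>2))"
      by (intro continuous_intros) auto
  qed (auto intro!: derivative_eq_intros simp: field_simps)
  also have "\<dots> = (\<integral>\<^sup>+t. 2 * (ennreal (1 / sqrt 2 * (1 / (t * (1 - t))))
      * indicator (circle_param -` B \<inter> {0<..<1}) t) \<partial>lborel)"
  proof (intro nn_integral_cong)
    fix t :: real
    have f: "f (2 * arctan t) =
        ennreal (1 / sqrt ((1 - fst (circle_param t)) * (1 - snd (circle_param t)))) * indicator B (circle_param t)"
      by (simp add: f_def cos_sin_double_arctan [symmetric])
    show "f (2 * arctan t) * ennreal (2 / (1 + t\<^sup>2)) * indicator {0..1} t =
      2 * (ennreal (1 / sqrt 2 * (1 / (t * (1 - t)))) * indicator (circle_param -` B \<inter> {0<..<1}) t)"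
    proof (cases "circle_param t \<in> B")
      case True
      then have t: "0 < t" "t < 1"
        using B circle_param_in_quarter_circle_iff by blast+
      have nonneg: "2 / (1 + t\<^sup>2) \<ge> 0"
        by simp
      have "ennreal (2 * x) = 2 * ennreal x" for x
        by (simp add: ennreal_mult')
      then have "ennreal (1 / sqrt ((1 - fst (circle_param t)) * (1 - snd (circle_param t)))) * ennreal (2 / (1 + t\<^sup>2))
          = 2 * ennreal (1 / sqrt 2 * (1 / (t * (1 - t))))"
        by (simp only: ennreal_mult'' [OF nonneg, symmetric] density [OF t])
      then show ?thesis
        using t True by (simp add: f)
    qed (simp add: f)
  qed
  also have "\<dots> = 2 * emeasure unit_interval_measure (circle_param -` B \<inter> {0<..<1})"
    using pre by (simp add: nn_integral_cmult emeasure_unit_interval_measure sets_unit_interval_measure)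
  finally show ?thesis .
qed

lemma conjugate_by_circle_param:
  "conjugate_by circle_param (1 / 2) unit_interval_measure interval_map circle_measure circle_map"
  unfolding conjugate_by_def space_unit_interval_measure space_circle_measure
proof (intro conjI ballI)
  show "bij_betw circle_param {0<..<1} quarter_circle"
    by (rule bij_betw_circle_param_quarter_circle)
  have borel: "circle_param \<in> borel_measurable borel"
    by (intro borel_measurable_continuous_onI continuous_on_circle_param)
  show meas: "circle_param \<in> measurable unit_interval_measure circle_measure"
    using borel measurable_sets [OF borel]
    by (intro measurableI) (auto simp: space_unit_interval_measure space_circle_measure
        circle_param_in_quarter_circle_iff sets_unit_interval_measure sets_circle_measure)
  show "inv_into {0<..<1} circle_param \<in> measurable circle_measure unit_interval_measure"
  proof -
    have inv: "inv_into {0<..<1} circle_param p = slope_through_pole p \<and> slope_through_pole p \<in> {0<..<1}"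
      if "p \<in> quarter_circle" for p
    proof -
      obtain t where "p = circle_param t" "t \<in> {0<..<1}"
        using \<open>p \<in> quarter_circle\<close> bij_betw_imp_surj_on [OF bij_betw_circle_param_quarter_circle] by blast
      then show ?thesis
        by (simp add: inv_into_f_f [OF inj_circle_param])
    qed
    have slope: "slope_through_pole \<in> borel_measurable borel"
      unfolding slope_through_pole_def borel_prod [symmetric] by measurable
    show ?thesis
    proof (intro measurableI)
      fix A assume A: "A \<in> sets unit_interval_measure"
      have "inv_into {0<..<1} circle_param -` A \<inter> quarter_circle = slope_through_pole -` A \<inter> quarter_circle"
        using inv by auto
      moreover have "slope_through_pole -` A \<in> sets borel"
        using A measurable_sets [OF slope, of A] by (simp add: sets_unit_interval_measure)
      ultimately show "inv_into {0<..<1} circle_param -` A \<inter> space circle_measure \<in> sets circle_measure"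
        by (auto simp: sets_circle_measure space_circle_measure)
    qed (use inv in \<open>simp add: space_circle_measure space_unit_interval_measure\<close>)
  qed
  show "circle_param (interval_map t) = circle_map (circle_param t)" if "t \<in> {0<..<1}" for t
    using that by (simp add: circle_param_interval_map)
  show "distr unit_interval_measure circle_measure circle_param = scale_measure (1 / 2) circle_measure"
  proof (rule measure_eqI)
    fix B assume "B \<in> sets (distr unit_interval_measure circle_measure circle_param)"
    then have B: "B \<in> sets circle_measure"
      by simp
    have "(1 / 2) * (2 * x) = x" for x :: ennreal
      by (simp add: mult.assoc [symmetric] ennreal_divide_times)
    then show "emeasure (distr unit_interval_measure circle_measure circle_param) B =
        emeasure (scale_measure (1 / 2) circle_measure) B"
      using B meas by (simp add: emeasure_distr emeasure_circle_measure space_unit_interval_measure)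
  qed simp
qed

text \<open>Invariance passes through the conjugacy because the constant \<open>c\<close> can be cancelled. Since \<open>S\<close> may
  leave \<open>space M\<close>, where \<open>\<phi>\<close> need not be injective, the last hypothesis demands that \<open>\<phi>\<close> does not bring
  such points back into \<open>space N\<close>; without it the preimages of a set under \<open>R\<close> and \<open>S\<close> need not
  correspond.\<close>

lemma measure_preserving_system_conjugate:
  assumes M: "measure_preserving_system M S"
    and conj: "conjugate_by \<phi> c M S N R"
    and c: "c \<noteq> 0" "c \<noteq> top"
    and stay: "\<And>x. x \<in> space M \<Longrightarrow> R (\<phi> x) \<in> space N \<Longrightarrow> S x \<in> space M"
  shows "measure_preserving_system N R"
proof -
  define \<psi> where "\<psi> = inv_into (space M) \<phi>"
  have bij: "bij_betw \<phi> (space M) (space N)"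
    and \<phi>: "\<phi> \<in> measurable M N" and \<psi>: "\<psi> \<in> measurable N M"
    and RS: "\<And>x. x \<in> space M \<Longrightarrow> R (\<phi> x) = \<phi> (S x)"
    and distr: "distr M N \<phi> = scale_measure c N"
    using conj by (auto simp: conjugate_by_def \<psi>_def)
  have \<phi>\<psi>: "\<phi> (\<psi> y) = y" "\<psi> y \<in> space M" if "y \<in> space N" for y
    using that bij measurable_space [OF \<psi>]
    by (auto simp: \<psi>_def bij_betw_def f_inv_into_f)
  have scaled: "emeasure M (\<phi> -` B \<inter> space M) = c * emeasure N B" if "B \<in> sets N" for B
    using that distr emeasure_distr [OF \<phi> that] by simp
  have pull: "\<phi> -` (R -` B \<inter> space N) \<inter> space M = S -` (\<phi> -` B \<inter> space M) \<inter> space M"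
    if "B \<in> sets N" for B
  proof -
    have "R (\<phi> x) \<in> B \<and> \<phi> x \<in> space N \<longleftrightarrow> \<phi> (S x) \<in> B \<and> S x \<in> space M" if "x \<in> space M" for x
      using stay [OF that] RS [OF that] measurable_space [OF \<phi> that] sets.sets_into_space [OF \<open>B \<in> sets N\<close>]
      by auto
    then show ?thesis
      by blast
  qed
  have meas: "R -` B \<inter> space N \<in> sets N" if B: "B \<in> sets N" for B
  proof -
    have "S -` (\<phi> -` B \<inter> space M) \<inter> space M \<in> sets M"
      using M measurable_sets [OF \<phi> B] unfolding measure_preserving_system_def by blast
    from measurable_sets [OF \<psi> this] have "\<psi> -` (\<phi> -` (R -` B \<inter> space N) \<inter> space M) \<inter> space N \<in> sets N"
      by (simp only: pull [OF B])
    also have "\<psi> -` (\<phi> -` (R -` B \<inter> space N) \<inter> space M) \<inter> space N = R -` B \<inter> space N"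
      using \<phi>\<psi> by auto
    finally show ?thesis .
  qed
  have "emeasure N (R -` B \<inter> space N) = emeasure N B" if B: "B \<in> sets N" for B
  proof -
    have "c * emeasure N (R -` B \<inter> space N) = emeasure M (\<phi> -` (R -` B \<inter> space N) \<inter> space M)"
      using scaled [OF meas [OF B]] by simp
    also have "\<dots> = emeasure M (\<phi> -` B \<inter> space M)"
      using M measurable_sets [OF \<phi> B] unfolding pull [OF B] measure_preserving_system_def by blast
    also have "\<dots> = c * emeasure N B"
      by (rule scaled [OF B])
    finally show ?thesis
      using c by (simp add: ennreal_mult_cancel_left)
  qed
  moreover have "AE y in N. R y \<in> space N"
  proof -
    have stays: "{y \<in> space N. R y \<in> space N} \<in> sets N"
    proof -
      have "{y \<in> space N. R y \<in> space N} = R -` space N \<inter> space N"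
        by auto
      then show ?thesis
        using meas [OF sets.top] by simp
    qed
    have "AE x in M. S x \<in> space M"
      using M by (simp add: measure_preserving_system_def)
    then have "AE x in M. R (\<phi> x) \<in> space N"
      by (rule AE_mp) (use RS measurable_space [OF \<phi>] in \<open>simp add: AE_I2\<close>)
    then have ae: "AE y in scale_measure c N. R y \<in> space N"
      using AE_distr_iff [OF \<phi> stays] unfolding distr by blast
    have leaves: "{y \<in> space N. R y \<notin> space N} \<in> sets N"
    proof -
      have "{y \<in> space N. R y \<notin> space N} = space N - {y \<in> space N. R y \<in> space N}"
        by auto
      then show ?thesis
        using stays by simp
    qed
    have "emeasure (scale_measure c N) {y \<in> space N. R y \<notin> space N} = 0"
      by (rule AE_iff_measurable [THEN iffD1, OF _ _ ae]) (simp_all add: leaves space_scale_measure)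
    then show ?thesis
      using c by (intro AE_iff_measurable [THEN iffD2, OF leaves]) simp_all
  qed
  ultimately show ?thesis
    using meas by (simp add: measure_preserving_system_def)
qed

lemma measure_preserving_circle_map: "measure_preserving_system circle_measure circle_map"
proof (rule measure_preserving_system_conjugate [OF measure_preserving_interval_map conjugate_by_circle_param])
  show "interval_map t \<in> space unit_interval_measure"
    if "t \<in> space unit_interval_measure" "circle_map (circle_param t) \<in> space circle_measure" for t
    using that circle_param_in_quarter_circle_iff [of "interval_map t"]
    by (simp add: space_unit_interval_measure space_circle_measure circle_param_interval_map)
qed (simp_all add: ennreal_divide_eq_top_iff)


theorem theorem4:
  shows "circle_map ` quarter_circle \<subseteq> closure quarter_circle \<and>
    bij_betw circle_param {0<..<1} quarter_circle \<and>
    bij_betw circle_param {0..1} (closure quarter_circle) \<and>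
    measure_preserving_system unit_interval_measure interval_map \<and>
    measure_preserving_system circle_measure circle_map \<and>
    conjugate_by circle_param (1 / 2) unit_interval_measure interval_map circle_measure circle_map \<and>
    (\<forall>t. 0 < t \<and> t < 1 / 3 \<longrightarrow> interval_map t = t / (1 - 2 * t)) \<and>
    (\<forall>t. 1 / 3 < t \<and> t < 1 / 2 \<longrightarrow> interval_map t = 1 / t - 2) \<and>
    (\<forall>t. 1 / 2 < t \<and> t < 1 \<longrightarrow> interval_map t = 2 - 1 / t) \<and>
    scaling_of slow_euclid interval_map"
proof (intro conjI allI impI)
  show "interval_map t = t / (1 - 2 * t)" if "0 < t \<and> t < 1 / 3" for t
    using that by (simp add: interval_map_eq slow_ratio_map_def)
  show "interval_map t = 1 / t - 2" if "1 / 3 < t \<and> t < 1 / 2" for t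
    using that by (simp add: interval_map_eq slow_ratio_map_def divide_simps)
  show "interval_map t = 2 - 1 / t" if "1 / 2 < t \<and> t < 1" for t
    using that by (simp add: interval_map_eq slow_ratio_map_def divide_simps)
qed (fact circle_map_image bij_betw_circle_param_quarter_circle bij_betw_circle_param_closure
    measure_preserving_interval_map measure_preserving_circle_map conjugate_by_circle_param
    scaling_of_slow_euclid)+

end
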